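(* For every instance $(G=(V,E),K,D,\Pi)$, $$z_{\mathrm{IP_{RWAP-PPP}}}\;\geq\; z_{\mathrm{LP_{RWAP-PPP}}}\;\geq\; z_{\mathrm{LP_{R1}}}\;=\;z_{\mathrm{LP_{R2}}}\;\geq\; z_{\mathrm{LP_{RWAP}}}.$$
   Context: An instance consists of: a finite undirected graph $G=(V,E)$ (parallel edges allowed), each edge $e=\{u,v\}\in E$ being a link between a pair of nodes; a finite set $K$ of wavelengths; a finite set $D$ of requests, each $d\in D$ having an origin $s_d\in V$ and a destination $t_d\in V$ (different requests may share the same pair); and a set $\Pi\subseteq E$ of links that may fail. For $e=\{u,v\}\in E$ let $\alpha_1(e)=(u,v)$ and $\alpha_2(e)=(v,u)$ be the two directed arcs associated with $e$ (arcs of different edges are different), $A=\{\alpha_1(e),\alpha_2(e):e\in E\}$, and let $A^+(v)$, $A^-(v)$ be the sets of arcs of $A$ leaving and entering $v\in V$. Variables: $x^{\kappa,a}_d$, $y^{\kappa,a}_{\tau,d}$, $w^{\kappa,e}$ for $d\in D$, $a\in A$, $\kappa\in K$, $\tau\in\Pi$, $e\in E$. Constraint group (X) (working paths): $\sum_{\kappa\in K}\sum_{a\in A^+(s_d)}x^{\kappa,a}_d=1$ and $\sum_{\kappa\in K}\sum_{a\in A^-(s_d)}x^{\kappa,a}_d=0$ for all $d\in D$; $\sum_{a\in A^-(v)}x^{\kappa,a}_d=\sum_{a\in A^+(v)}x^{\kappa,a}_d$ for all $d\in D,\kappa\in K,v\in V\setminus\{s_d,t_d\}$; $\sum_{d\in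 D}(x^{\kappa,\alpha_1(e)}_d+x^{\kappa,\alpha_2(e)}_d)\le w^{\kappa,e}$ for all $\kappa\in K,e\in E$. Constraint group (Y) (backup paths): $\sum_{a\in A^+(s_d)}\sum_{\kappa\in K}y^{\kappa,a}_{\tau,d}=1$ and $\sum_{a\in A^-(s_d)}\sum_{\kappa\in K}y^{\kappa,a}_{\tau,d}=0$ for all $\tau\in\Pi,d\in D$; $\sum_{a\in A^-(v)}y^{\kappa,a}_{\tau,d}=\sum_{a\in A^+(v)}y^{\kappa,a}_{\tau,d}$ for all $\tau\in\Pi,d\in D,\kappa\in K,v\in V\setminus\{s_d,t_d\}$; $\sum_{d\in D}(y^{\kappa,\alpha_1(e)}_{\tau,d}+y^{\kappa,\alpha_2(e)}_{\tau,d})\le w^{\kappa,e}$ for all $\tau\in\Pi,\kappa\in K,e\in E$; $y^{\kappa,\alpha_1(\tau)}_{\tau,d}+y^{\kappa,\alpha_2(\tau)}_{\tau,d}=0$ for all $\tau\in\Pi,d\in D,\kappa\in K$. Constraint group (XY) (linking): for all $\tau\in\Pi,d\in D,\kappa\in K,a\in A$, $x^{\kappa,a}_d-\sum_{\kappa'\in K}(x^{\kappa',\alpha_1(\tau)}_d+x^{\kappa',\alpha_2(\tau)}_d)\le y^{\kappa,a}_{\tau,d}\le x^{\kappa,a}_d+\sum_{\kappa'\in K}(x^{\kappa',\alpha_1(\tau)}_d+x^{\kappa',\alpha_2(\tau)}_d)$. All integer models minimize $\sum_{\kappa\in K}\sum_{e\in E}w^{\kappa,e}$ with all their variables in $\{0,1\}$: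 $\mathrm{IP_{RWAP-PPP}}$: variables $x,y,w$, constraints (X), (Y), (XY); $\mathrm{IP_{R1}}$: variables $x,y,w$, constraints (X), (Y); $\mathrm{IP_{R2}}$: variables $y,w$, constraints (Y); $\mathrm{IP_{RWAP}}$: variables $x,w$, constraints (X). $\mathrm{LP_{RWAP-PPP}},\mathrm{LP_{R1}},\mathrm{LP_{R2}},\mathrm{LP_{RWAP}}$ are the LP relaxations of the corresponding integer programs, obtained by replacing $\{0,1\}$ by $[0,1]$ for every variable. $z_M$ denotes the optimal objective value of model $M$, with the convention $z_M=+\infty$ if $M$ is infeasible.
   Formalization: The claims z_LP_R1 = z_LP_R2 and z_LP_R2 ≥ z_LP_RWAP are stated only when Π is nonempty or D is empty; if Π is empty and D is not, z_LP_R2 = 0 while z_LP_R1 and z_LP_RWAP are at least 1. The other inequalities (and z_LP_R1 ≥ z_LP_RWAP) hold for every instance. *)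

theory Defs
  imports "HOL-Library.Extended_Real"
begin

text \<open>
  Links are abstract identifiers, so that several links may join the same pair of nodes.
  The two ends of a link \<open>e\<close> are listed as \<open>end1 e\<close>, \<open>end2 e\<close>; the order only fixes which
  of the two arcs of \<open>e\<close> is called the first one.  Loops are not excluded.
\<close>

record ('v, 'e, 'k, 'd) rwap =
  nodes :: "'v set"
  links :: "'e set"
  end1 :: "'e \<Rightarrow> 'v"
  end2 :: "'e \<Rightarrow> 'v"
  wavelengths :: "'k set"
  requests :: "'d set"
  origin :: "'d \<Rightarrow> 'v"
  destination :: "'d \<Rightarrow> 'v"
  failing :: "'e set"

definition rwap_instance :: "('v, 'e, 'k, 'd) rwap \<Rightarrow> bool" where
  "rwap_instance I \<longleftrightarrow>
     finite (nodes I) \<and> finite (links I) \<and> finite (wavelengths I) \<and> finite (requests I) \<and>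
     (\<forall>e\<in>links I. end1 I e \<in> nodes I \<and> end2 I e \<in> nodes I) \<and>
     (\<forall>d\<in>requests I. origin I d \<in> nodes I \<and> destination I d \<in> nodes I) \<and>
     failing I \<subseteq> links I"

datatype 'e arc = Arc1 'e | Arc2 'e

fun arc_tail :: "('v, 'e, 'k, 'd) rwap \<Rightarrow> 'e arc \<Rightarrow> 'v" where
  "arc_tail I (Arc1 e) = end1 I e"
| "arc_tail I (Arc2 e) = end2 I e"

fun arc_head :: "('v, 'e, 'k, 'd) rwap \<Rightarrow> 'e arc \<Rightarrow> 'v" where
  "arc_head I (Arc1 e) = end2 I e"
| "arc_head I (Arc2 e) = end1 I e"

definition arcs :: "('v, 'e, 'k, 'd) rwap \<Rightarrow> 'e arc set" where
  "arcs I = Arc1 ` links I \<union> Arc2 ` links I"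

definition out_arcs :: "('v, 'e, 'k, 'd) rwap \<Rightarrow> 'v \<Rightarrow> 'e arc set" where
  "out_arcs I v = {a \<in> arcs I. arc_tail I a = v}"

definition in_arcs :: "('v, 'e, 'k, 'd) rwap \<Rightarrow> 'v \<Rightarrow> 'e arc set" where
  "in_arcs I v = {a \<in> arcs I. arc_head I a = v}"

text \<open>
  Argument order of the variables: \<open>x d \<kappa> a\<close>, \<open>y \<tau> d \<kappa> a\<close>, \<open>w \<kappa> e\<close>.  They are total functions,
  but constraints and objective only involve their values on the index sets of the instance.
\<close>

type_synonym ('e, 'k, 'd) xvar = "'d \<Rightarrow> 'k \<Rightarrow> 'e arc \<Rightarrow> real"
type_synonym ('e, 'k, 'd) yvar = "'e \<Rightarrow> 'd \<Rightarrow> 'k \<Rightarrow> 'e arc \<Rightarrow> real"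
type_synonym ('e, 'k) wvar = "'k \<Rightarrow> 'e \<Rightarrow> real"

definition constr_X ::
  "('v, 'e, 'k, 'd) rwap \<Rightarrow> ('e, 'k, 'd) xvar \<Rightarrow> ('e, 'k) wvar \<Rightarrow> bool" where
  "constr_X I x w \<longleftrightarrow>
     (\<forall>d\<in>requests I.
        (\<Sum>\<kappa>\<in>wavelengths I. \<Sum>a\<in>out_arcs I (origin I d). x d \<kappa> a) = 1 \<and>
        (\<Sum>\<kappa>\<in>wavelengths I. \<Sum>a\<in>in_arcs I (origin I d). x d \<kappa> a) = 0) \<and>
     (\<forall>d\<in>requests I. \<forall>\<kappa>\<in>wavelengths I. \<forall>v\<in>nodes I - {origin I d, destination I d}.
        (\<Sum>a\<in>in_arcs I v. x d \<kappa> a) = (\<Sum>a\<in>out_arcs I v. x d \<kappa> a)) \<and>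
     (\<forall>\<kappa>\<in>wavelengths I. \<forall>e\<in>links I.
        (\<Sum>d\<in>requests I. x d \<kappa> (Arc1 e) + x d \<kappa> (Arc2 e)) \<le> w \<kappa> e)"

definition constr_Y ::
  "('v, 'e, 'k, 'd) rwap \<Rightarrow> ('e, 'k, 'd) yvar \<Rightarrow> ('e, 'k) wvar \<Rightarrow> bool" where
  "constr_Y I y w \<longleftrightarrow>
     (\<forall>\<tau>\<in>failing I. \<forall>d\<in>requests I.
        (\<Sum>a\<in>out_arcs I (origin I d). \<Sum>\<kappa>\<in>wavelengths I. y \<tau> d \<kappa> a) = 1 \<and>
        (\<Sum>a\<in>in_arcs I (origin I d). \<Sum>\<kappa>\<in>wavelengths I. y \<tau> d \<kappa> a) = 0) \<and>
     (\<forall>\<tau>\<in>failing I. \<forall>d\<in>requests I. \<forall>\<kappa>\<in>wavelengths I.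
        \<forall>v\<in>nodes I - {origin I d, destination I d}.
        (\<Sum>a\<in>in_arcs I v. y \<tau> d \<kappa> a) = (\<Sum>a\<in>out_arcs I v. y \<tau> d \<kappa> a)) \<and>
     (\<forall>\<tau>\<in>failing I. \<forall>\<kappa>\<in>wavelengths I. \<forall>e\<in>links I.
        (\<Sum>d\<in>requests I. y \<tau> d \<kappa> (Arc1 e) + y \<tau> d \<kappa> (Arc2 e)) \<le> w \<kappa> e) \<and>
     (\<forall>\<tau>\<in>failing I. \<forall>d\<in>requests I. \<forall>\<kappa>\<in>wavelengths I.
        y \<tau> d \<kappa> (Arc1 \<tau>) + y \<tau> d \<kappa> (Arc2 \<tau>) = 0)"

definition constr_XY ::
  "('v, 'e, 'k, 'd) rwap \<Rightarrow> ('e, 'k, 'd) xvar \<Rightarrow> ('e, 'k, 'd) yvar \<Rightarrow> bool" where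
  "constr_XY I x y \<longleftrightarrow>
     (\<forall>\<tau>\<in>failing I. \<forall>d\<in>requests I. \<forall>\<kappa>\<in>wavelengths I. \<forall>a\<in>arcs I.
        x d \<kappa> a - (\<Sum>\<kappa>'\<in>wavelengths I. x d \<kappa>' (Arc1 \<tau>) + x d \<kappa>' (Arc2 \<tau>)) \<le> y \<tau> d \<kappa> a \<and>
        y \<tau> d \<kappa> a \<le> x d \<kappa> a + (\<Sum>\<kappa>'\<in>wavelengths I. x d \<kappa>' (Arc1 \<tau>) + x d \<kappa>' (Arc2 \<tau>)))"

definition dom_x :: "real set \<Rightarrow> ('v, 'e, 'k, 'd) rwap \<Rightarrow> ('e, 'k, 'd) xvar \<Rightarrow> bool" where
  "dom_x S I x \<longleftrightarrow> (\<forall>d\<in>requests I. \<forall>\<kappa>\<in>wavelengths I. \<forall>a\<in>arcs I. x d \<kappa> a \<in> S)"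

definition dom_y :: "real set \<Rightarrow> ('v, 'e, 'k, 'd) rwap \<Rightarrow> ('e, 'k, 'd) yvar \<Rightarrow> bool" where
  "dom_y S I y \<longleftrightarrow>
     (\<forall>\<tau>\<in>failing I. \<forall>d\<in>requests I. \<forall>\<kappa>\<in>wavelengths I. \<forall>a\<in>arcs I. y \<tau> d \<kappa> a \<in> S)"

definition dom_w :: "real set \<Rightarrow> ('v, 'e, 'k, 'd) rwap \<Rightarrow> ('e, 'k) wvar \<Rightarrow> bool" where
  "dom_w S I w \<longleftrightarrow> (\<forall>\<kappa>\<in>wavelengths I. \<forall>e\<in>links I. w \<kappa> e \<in> S)"

definition objective :: "('v, 'e, 'k, 'd) rwap \<Rightarrow> ('e, 'k) wvar \<Rightarrow> real" where
  "objective I w = (\<Sum>\<kappa>\<in>wavelengths I. \<Sum>e\<in>links I. w \<kappa> e)"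

text \<open>
  The parameter \<open>S\<close> is the range of every variable: \<open>{0, 1}\<close> gives an integer program and
  \<open>{0..1}\<close> its LP relaxation.  The optimal value is an infimum in the extended reals, so that an
  infeasible model has value \<open>\<infinity>\<close>; for a feasible model the infimum is attained, because the
  feasible region (restricted to the finitely many relevant coordinates) is compact.
\<close>

definition z_RWAP_PPP :: "real set \<Rightarrow> ('v, 'e, 'k, 'd) rwap \<Rightarrow> ereal" where
  "z_RWAP_PPP S I = Inf {ereal (objective I w) | x y w.
     dom_x S I x \<and> dom_y S I y \<and> dom_w S I w \<and>
     constr_X I x w \<and> constr_Y I y w \<and> constr_XY I x y}"

definition z_R1 :: "real set \<Rightarrow> ('v, 'e, 'k, 'd) rwap \<Rightarrow> ereal" where
  "z_R1 S I = Inf {ereal (objective I w) | x y w.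
     dom_x S I x \<and> dom_y S I y \<and> dom_w S I w \<and> constr_X I x w \<and> constr_Y I y w}"

definition z_R2 :: "real set \<Rightarrow> ('v, 'e, 'k, 'd) rwap \<Rightarrow> ereal" where
  "z_R2 S I = Inf {ereal (objective I w) | y w.
     dom_y S I y \<and> dom_w S I w \<and> constr_Y I y w}"

definition z_RWAP :: "real set \<Rightarrow> ('v, 'e, 'k, 'd) rwap \<Rightarrow> ereal" where
  "z_RWAP S I = Inf {ereal (objective I w) | x w.
     dom_x S I x \<and> dom_w S I w \<and> constr_X I x w}"

definition z_IP_RWAP_PPP :: "('v, 'e, 'k, 'd) rwap \<Rightarrow> ereal" where
  "z_IP_RWAP_PPP = z_RWAP_PPP {0, 1}"

definition z_LP_RWAP_PPP :: "('v, 'e, 'k, 'd) rwap \<Rightarrow> ereal" where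
  "z_LP_RWAP_PPP = z_RWAP_PPP {0..1}"

definition z_LP_R1 :: "('v, 'e, 'k, 'd) rwap \<Rightarrow> ereal" where
  "z_LP_R1 = z_R1 {0..1}"

definition z_LP_R2 :: "('v, 'e, 'k, 'd) rwap \<Rightarrow> ereal" where
  "z_LP_R2 = z_R2 {0..1}"

definition z_LP_RWAP :: "('v, 'e, 'k, 'd) rwap \<Rightarrow> ereal" where
  "z_LP_RWAP = z_RWAP {0..1}"

end

theory Submission
  imports Defs
begin

text \<open>
  Every inequality drops constraints, integrality or variables.  Conversely, the backup paths for
  one fixed failing link satisfy all the constraints imposed on the working paths, with the same
  \<open>w\<close>; hence every solution of R2 extends to one of R1 at equal cost.
\<close>

lemma dom_x_mono: "S \<subseteq> T \<Longrightarrow> dom_x S I x \<Longrightarrow> dom_x T I x"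
  unfolding dom_x_def by blast

lemma dom_y_mono: "S \<subseteq> T \<Longrightarrow> dom_y S I y \<Longrightarrow> dom_y T I y"
  unfolding dom_y_def by blast

lemma dom_w_mono: "S \<subseteq> T \<Longrightarrow> dom_w S I w \<Longrightarrow> dom_w T I w"
  unfolding dom_w_def by blast

text \<open>A larger range of the variables enlarges the feasible set; LP relaxation is the case
  \<open>{0, 1}\<close> inside \<open>{0..1}\<close>.\<close>

lemma z_RWAP_PPP_antimono: "S \<subseteq> T \<Longrightarrow> z_RWAP_PPP T I \<le> z_RWAP_PPP S I"
  unfolding z_RWAP_PPP_def
  by (rule Inf_superset_mono) (blast intro: dom_x_mono dom_y_mono dom_w_mono)

lemma z_R1_le_z_RWAP_PPP: "z_R1 S I \<le> z_RWAP_PPP S I"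
  unfolding z_R1_def z_RWAP_PPP_def by (rule Inf_superset_mono) blast

lemma z_RWAP_le_z_R1: "z_RWAP S I \<le> z_R1 S I"
  unfolding z_RWAP_def z_R1_def by (rule Inf_superset_mono) blast

lemma z_R2_le_z_R1: "z_R2 S I \<le> z_R1 S I"
  unfolding z_R2_def z_R1_def by (rule Inf_superset_mono) blast

text \<open>For fixed \<open>\<tau>\<close>, (Y) repeats (X) and adds the ban on
  \<open>\<tau>\<close>; only the order of summation at the origin differs.\<close>

lemma constr_X_backup:
  assumes "constr_Y I y w" and "\<tau> \<in> failing I"
  shows "constr_X I (y \<tau>) w"
proof -
  have "(\<Sum>\<kappa>\<in>wavelengths I. \<Sum>a\<in>A. y \<tau> d \<kappa> a) = (\<Sum>a\<in>A. \<Sum>\<kappa>\<in>wavelengths I. y \<tau> d \<kappa> a)"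
    for d A
    by (rule sum.swap)
  with assms show ?thesis
    unfolding constr_X_def constr_Y_def by simp
qed

text \<open>With requests but no failing link, (Y) is vacuous: over \<open>{0..1}\<close>, R2 then
  has value 0, while (X) forces cost at least 1.\<close>

lemma z_R1_le_z_R2:
  assumes "failing I \<noteq> {} \<or> requests I = {}"
    and nonneg: "S \<subseteq> {0..}"
  shows "z_R1 S I \<le> z_R2 S I"
proof -
  have "\<exists>x. dom_x S I x \<and> constr_X I x w"
    if y: "dom_y S I y" "constr_Y I y w" and w: "dom_w S I w" for y w
  proof (cases "requests I = {}")
    case True
    \<comment> \<open>Any \<open>x\<close> will do: without requests, (X) reduces to
      \<open>0 \<le> w \<kappa> e\<close>, which is where \<open>nonneg\<close> enters.\<close>
    then show ?thesis
      using w nonneg unfolding dom_x_def dom_w_def constr_X_def by auto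
  next
    case False
    then obtain \<tau> where "\<tau> \<in> failing I"
      using assms by blast
    then have "dom_x S I (y \<tau>)"
      using y(1) unfolding dom_x_def dom_y_def by blast
    with constr_X_backup [OF y(2) \<open>\<tau> \<in> failing I\<close>] show ?thesis
      by blast
  qed
  \<comment> \<open>The objective depends on \<open>w\<close> alone, so adding \<open>x\<close>
    keeps the cost.\<close>
  then show ?thesis
    unfolding z_R1_def z_R2_def by (intro Inf_superset_mono) blast
qed

theorem theorem2:
  fixes I :: "('v, 'e, 'k, 'd) rwap"
  assumes "rwap_instance I"
  shows "z_IP_RWAP_PPP I \<ge> z_LP_RWAP_PPP I \<and>
         z_LP_RWAP_PPP I \<ge> z_LP_R1 I \<and>
         z_LP_R1 I \<ge> z_LP_RWAP I \<and>
         (failing I \<noteq> {} \<or> requests I = {} \<longrightarrow>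
            z_LP_R1 I = z_LP_R2 I \<and> z_LP_R2 I \<ge> z_LP_RWAP I)"
proof (intro conjI)
  show "z_IP_RWAP_PPP I \<ge> z_LP_RWAP_PPP I"
    unfolding z_IP_RWAP_PPP_def z_LP_RWAP_PPP_def by (rule z_RWAP_PPP_antimono) simp
  show "z_LP_RWAP_PPP I \<ge> z_LP_R1 I"
    unfolding z_LP_RWAP_PPP_def z_LP_R1_def by (rule z_R1_le_z_RWAP_PPP)
  \<comment> \<open>R1 is compared with RWAP directly, not through R2, so this also covers the case
    where no link can fail.\<close>
  show R1: "z_LP_R1 I \<ge> z_LP_RWAP I"
    unfolding z_LP_R1_def z_LP_RWAP_def by (rule z_RWAP_le_z_R1)
  show "failing I \<noteq> {} \<or> requests I = {} \<longrightarrow>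
      z_LP_R1 I = z_LP_R2 I \<and> z_LP_R2 I \<ge> z_LP_RWAP I"
  proof
    assume "failing I \<noteq> {} \<or> requests I = {}"
    then have "z_LP_R1 I \<le> z_LP_R2 I"
      unfolding z_LP_R1_def z_LP_R2_def by (rule z_R1_le_z_R2) simp
    moreover have "z_LP_R2 I \<le> z_LP_R1 I"
      unfolding z_LP_R1_def z_LP_R2_def by (rule z_R2_le_z_R1)
    ultimately show "z_LP_R1 I = z_LP_R2 I \<and> z_LP_R2 I \<ge> z_LP_RWAP I"
      using R1 by simp
  qed
qed

end
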